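(* Let $P=(X,\prec)$ be a finite poset with $|X|=n$ elements. Then for every $t\in\mathbb N$, $$\Omega(P,t)\ \geq\ \frac{e(P)\,t^n}{n!}.$$
   Context: $\Omega(P,t)$ is the number of maps $g:X\to[t]=\{1,\dots,t\}$ with $g(x)\le g(y)$ whenever $x\prec y$. $e(P)$ is the number of linear extensions of $P$, i.e. bijections $f:X\to[n]$ with $f(x)<f(y)$ whenever $x\prec y$. *)

theory Defs
  imports Complex_Main "HOL-Library.FuncSet"
begin

text \<open>
  A poset is given by its strict order: \<open>x \<prec> y\<close> is \<open>prec x y\<close>, and only the values of \<open>prec\<close>
  on \<open>X\<close> matter.
\<close>

definition finite_poset :: "'a set \<Rightarrow> ('a \<Rightarrow> 'a \<Rightarrow> bool) \<Rightarrow> bool" where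
  "finite_poset X prec \<longleftrightarrow> finite X \<and> irreflp_on X prec \<and> transp_on X prec"

text \<open>
  Maps with domain \<open>X\<close> are taken in the extensional function space \<open>\<rightarrow>\<^sub>E\<close>
  (value \<open>undefined\<close> outside \<open>X\<close>), so that each map \<open>X \<rightarrow> [t]\<close> is counted exactly once.
\<close>

definition order_preserving_maps :: "'a set \<Rightarrow> ('a \<Rightarrow> 'a \<Rightarrow> bool) \<Rightarrow> nat \<Rightarrow> ('a \<Rightarrow> nat) set" where
  "order_preserving_maps X prec t =
     {g \<in> X \<rightarrow>\<^sub>E {1..t}. \<forall>x\<in>X. \<forall>y\<in>X. prec x y \<longrightarrow> g x \<le> g y}"

definition order_poly :: "'a set \<Rightarrow> ('a \<Rightarrow> 'a \<Rightarrow> bool) \<Rightarrow> nat \<Rightarrow> nat" where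
  "order_poly X prec t = card (order_preserving_maps X prec t)"

definition linear_extensions :: "'a set \<Rightarrow> ('a \<Rightarrow> 'a \<Rightarrow> bool) \<Rightarrow> ('a \<Rightarrow> nat) set" where
  "linear_extensions X prec =
     {f \<in> X \<rightarrow>\<^sub>E {1..card X}.
        bij_betw f X {1..card X} \<and> (\<forall>x\<in>X. \<forall>y\<in>X. prec x y \<longrightarrow> f x < f y)}"

definition num_linear_extensions :: "'a set \<Rightarrow> ('a \<Rightarrow> 'a \<Rightarrow> bool) \<Rightarrow> nat" where
  "num_linear_extensions X prec = card (linear_extensions X prec)"

end

theory Submission
  imports Defs
begin

text \<open>
  Splitting the values of a map into \<open>[k t]\<close> by division with remainder by \<open>k\<close> gives
  \<open>\<Omega>(P, k t) \<le> k ^ n \<Omega>(P, t)\<close>. On the other hand \<open>\<Omega>(P, m) \<ge> e(P) (m choose n)\<close>, because a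
  linear extension together with an \<open>n\<close>-element subset of \<open>[m]\<close> determines an injective
  order-preserving map. Hence \<open>e(P) (k t choose n) / k ^ n \<le> \<Omega>(P, t)\<close>, and \<open>k \<rightarrow> \<infinity>\<close> gives the claim.
\<close>

lemma finite_order_preserving_maps:
  assumes "finite X"
  shows "finite (order_preserving_maps X prec t)"
  unfolding order_preserving_maps_def
  by (rule finite_subset[OF _ finite_PiE[of X "\<lambda>_. {1..t}"]]) (use assms in auto)

text \<open>Division by \<open>k\<close> is monotone, so the quotients of an order-preserving map
  again form one. The remainders are kept as an arbitrary map into \<open>{..<k}\<close>, which
  accounts for the factor \<open>k ^ card X\<close>.\<close>

lemma order_poly_mult_le:
  assumes "finite X" and "k > 0"
  shows "order_poly X prec (k * t) \<le> order_poly X prec t * k ^ card X"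
proof -
  define F :: "('a \<Rightarrow> nat) \<Rightarrow> ('a \<Rightarrow> nat) \<times> ('a \<Rightarrow> nat)" where
    \<comment> \<open>Values start at 1, so the division is applied to \<open>g x - 1\<close>, and
      the quotient is shifted back to land in \<open>{1..t}\<close>.\<close>
    "F g = (\<lambda>x\<in>X. (g x - 1) div k + 1, \<lambda>x\<in>X. (g x - 1) mod k)" for g
  have "inj_on F (order_preserving_maps X prec (k * t))"
  proof (rule inj_onI)
    fix g h
    assume g: "g \<in> order_preserving_maps X prec (k * t)"
      and h: "h \<in> order_preserving_maps X prec (k * t)" and eq: "F g = F h"
    have PiE: "g \<in> X \<rightarrow>\<^sub>E {1..k * t}" "h \<in> X \<rightarrow>\<^sub>E {1..k * t}"
      using g h by (auto simp: order_preserving_maps_def)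
    show "g = h"
    proof (rule PiE_ext[OF PiE])
      fix x assume x: "x \<in> X"
      have "(g x - 1) div k = (h x - 1) div k" "(g x - 1) mod k = (h x - 1) mod k"
        using eq x by (auto simp: F_def dest!: fun_cong[of _ _ x])
      then have "g x - 1 = h x - 1"
        by (metis div_mult_mod_eq)
      \<comment> \<open>Subtraction on \<open>nat\<close> truncates at 0; these bounds make it
        reversible.\<close>
      moreover have "g x \<ge> 1" "h x \<ge> 1"
        using PiE x by (auto dest!: PiE_mem)
      ultimately show "g x = h x" by linarith
    qed
  qed
  moreover have "F ` order_preserving_maps X prec (k * t)
      \<subseteq> order_preserving_maps X prec t \<times> (X \<rightarrow>\<^sub>E {..<k})"
  proof (rule image_subsetI)
    fix g assume g: "g \<in> order_preserving_maps X prec (k * t)"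
    have "(g x - 1) div k < t" if "x \<in> X" for x
    proof -
      have "g x \<in> {1..k * t}"
        using g that by (auto simp: order_preserving_maps_def)
      then have "g x - 1 < t * k" by (auto simp: mult.commute)
      then show ?thesis by (rule less_mult_imp_div_less)
    qed
    then show "F g \<in> order_preserving_maps X prec t \<times> (X \<rightarrow>\<^sub>E {..<k})"
      using g assms by (auto simp: F_def order_preserving_maps_def Suc_le_eq less_Suc_eq_le
          intro!: div_le_mono diff_le_mono)
  qed
  moreover have "finite (order_preserving_maps X prec t \<times> (X \<rightarrow>\<^sub>E {..<k}))"
    using assms by (intro finite_cartesian_product finite_order_preserving_maps finite_PiE) auto
  ultimately have "card (order_preserving_maps X prec (k * t))
      \<le> card (order_preserving_maps X prec t \<times> (X \<rightarrow>\<^sub>E {..<k}))"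
    by (rule card_inj_on_le)
  then show ?thesis
    using assms by (simp add: order_poly_def card_cartesian_product card_PiE)
qed

text \<open>Use \<open>f\<close> as a ranking: \<open>x\<close> is sent to the \<open>f x\<close>-th
  smallest element of \<open>S\<close>. The set \<open>S\<close> is recovered as the image of the
  resulting map, and then \<open>f x\<close> as the position of the value of \<open>x\<close> in
  \<open>S\<close>.\<close>

lemma num_linear_extensions_mult_choose_le:
  assumes "finite X"
  shows "num_linear_extensions X prec * (m choose card X) \<le> order_poly X prec m"
proof -
  define A where "A = linear_extensions X prec \<times> {S. S \<subseteq> {1..m} \<and> card S = card X}"
  define F :: "('a \<Rightarrow> nat) \<times> nat set \<Rightarrow> 'a \<Rightarrow> nat" where
    \<comment> \<open>List positions start at 0 while ranks start at 1, hence
      \<open>f x - 1\<close>.\<close>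
    "F = (\<lambda>(f, S). \<lambda>x\<in>X. sorted_list_of_set S ! (f x - 1))"
  have image: "F (f, S) ` X = S" if "(f, S) \<in> A" for f S
  proof -
    have S: "finite S" "card S = card X" and f: "f ` X = {1..card X}"
      using that by (auto simp: A_def linear_extensions_def bij_betw_def intro: finite_subset)
    have "F (f, S) ` X = (\<lambda>i. sorted_list_of_set S ! (i - 1)) ` f ` X"
      by (auto simp: F_def)
    also have "\<dots> = (\<lambda>i. sorted_list_of_set S ! i) ` {0..<card X}"
      unfolding f image_Suc_atLeastLessThan[symmetric] atLeastLessThanSuc_atLeastAtMost[symmetric]
      by (simp add: image_image flip: image_Suc_atLeastLessThan)
    also have "\<dots> = set (sorted_list_of_set S)"
      using S by (auto simp: set_conv_nth)
    finally show ?thesis using S by simp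
  qed
  have "inj_on F A"
  proof (rule inj_onI, clarify)
    fix f S g T assume A: "(f, S) \<in> A" "(g, T) \<in> A" and eq: "F (f, S) = F (g, T)"
    have T: "T = S" using image[OF A(1)] image[OF A(2)] eq by simp
    have f: "f \<in> X \<rightarrow>\<^sub>E {1..card X}" and g: "g \<in> X \<rightarrow>\<^sub>E {1..card X}"
      and S: "card S = card X"
      using A by (auto simp: A_def linear_extensions_def)
    have "f = g"
    proof (rule PiE_ext[OF f g])
      fix x assume x: "x \<in> X"
      have range: "f x \<in> {1..card X}" "g x \<in> {1..card X}"
        using f g x by (auto dest: PiE_mem)
      have "sorted_list_of_set S ! (f x - 1) = sorted_list_of_set S ! (g x - 1)"
        using fun_cong[OF eq, of x] x T by (simp add: F_def)
      then have "f x - 1 = g x - 1"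
        \<comment> \<open>The sorted list of a set has distinct entries, so equal entries at valid
          positions have equal positions.\<close>
        using range S by (subst (asm) nth_eq_iff_index_eq) auto
      then show "f x = g x" using range by auto
    qed
    with T show "f = g \<and> S = T" by simp
  qed
  moreover have "F ` A \<subseteq> order_preserving_maps X prec m"
  proof (rule image_subsetI, clarify)
    fix f S assume A: "(f, S) \<in> A"
    then have f: "f \<in> X \<rightarrow>\<^sub>E {1..card X}" "\<And>x y. x \<in> X \<Longrightarrow> y \<in> X \<Longrightarrow> prec x y \<Longrightarrow> f x < f y"
      and S: "S \<subseteq> {1..m}" "card S = card X"
      by (auto simp: A_def linear_extensions_def)
    have "F (f, S) \<in> X \<rightarrow>\<^sub>E {1..m}"
      using image[OF A] S(1) by (fastforce simp: F_def)
    moreover have "F (f, S) x \<le> F (f, S) y" if "x \<in> X" "y \<in> X" "prec x y" for x y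
    proof -
      have "f x < f y" "f y \<in> {1..card X}" using f that by auto
      then have "f x - 1 \<le> f y - 1" "f y - 1 < length (sorted_list_of_set S)"
        using S by auto
      then show ?thesis
        using that by (simp add: F_def sorted_nth_mono)
    qed
    ultimately show "F (f, S) \<in> order_preserving_maps X prec m"
      by (simp add: order_preserving_maps_def)
  qed
  ultimately have "card A \<le> card (order_preserving_maps X prec m)"
    using finite_order_preserving_maps[OF assms] by (rule card_inj_on_le)
  then show ?thesis
    by (simp add: A_def card_cartesian_product n_subsets num_linear_extensions_def order_poly_def)
qed

text \<open>Distributing \<open>k ^ n\<close> over the \<open>n\<close> factors of the falling
  factorial of \<open>k * t\<close> turns them into \<open>t - i / k\<close>. Their number does not
  depend on \<open>k\<close>, and each tends to \<open>t\<close>.\<close>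

lemma tendsto_choose_div_power:
  "(\<lambda>k. real (k * t choose n) / real k ^ n) \<longlonglongrightarrow> real t ^ n / fact n"
proof -
  have "(\<lambda>k. (\<Prod>i = 0..<n. real t - real i / real k) / fact n)
      \<longlonglongrightarrow> (\<Prod>i = 0..<n. real t - 0) / fact n"
    by (intro tendsto_intros tendsto_divide_0[OF tendsto_const]
        filterlim_at_top_imp_at_infinity filterlim_real_sequentially) auto
  \<comment> \<open>The identity needs only \<open>k > 0\<close>: if \<open>k * t < n\<close>, the
    factor at \<open>i = k * t\<close> is 0, and so is the binomial coefficient.\<close>
  moreover have "\<forall>\<^sub>F k in sequentially.
      (\<Prod>i = 0..<n. real t - real i / real k) / fact n = real (k * t choose n) / real k ^ n"
  proof (rule eventually_mono[OF eventually_gt_at_top[of 0]])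
    fix k :: nat assume "k > 0"
    then have "(\<Prod>i = 0..<n. real t - real i / real k)
        = (\<Prod>i = 0..<n. (real (k * t) - real i) / real k)"
      by (intro prod.cong) (auto simp: field_simps)
    then show "(\<Prod>i = 0..<n. real t - real i / real k) / fact n = real (k * t choose n) / real k ^ n"
      by (simp add: binomial_gbinomial gbinomial_prod_rev prod_dividef)
  qed
  ultimately show ?thesis
    by (simp add: tendsto_cong)
qed

theorem theorem1p4:
  fixes X :: "'a set" and prec :: "'a \<Rightarrow> 'a \<Rightarrow> bool" and n t :: nat
  assumes "finite_poset X prec"
    and "card X = n"
  shows "real (order_poly X prec t) \<ge> real (num_linear_extensions X prec) * real t ^ n / fact n"
proof -
  have X: "finite X" using assms(1) by (simp add: finite_poset_def)
  let ?e = "num_linear_extensions X prec" and ?\<Omega> = "order_poly X prec t"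
  have "(\<lambda>k. real ?e * (real (k * t choose n) / real k ^ n)) \<longlonglongrightarrow> real ?e * (real t ^ n / fact n)"
    by (intro tendsto_mult_left tendsto_choose_div_power)
  moreover have "real ?e * (real (k * t choose n) / real k ^ n) \<le> real ?\<Omega>" if "k \<ge> 1" for k
  proof -
    \<comment> \<open>Both counting bounds meet at \<open>order_poly X prec (k * t)\<close>, which
      is eliminated by transitivity.\<close>
    have "?e * (k * t choose n) \<le> ?\<Omega> * k ^ n"
      using num_linear_extensions_mult_choose_le[OF X, of prec "k * t"]
        order_poly_mult_le[OF X, of k prec t] that assms(2) by simp
    then have "real ?e * real (k * t choose n) \<le> real ?\<Omega> * real k ^ n"
      unfolding of_nat_power[symmetric] of_nat_mult[symmetric] of_nat_le_iff .
    then show ?thesis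
      using that by (simp add: divide_le_eq)
  qed
  ultimately have "real ?e * (real t ^ n / fact n) \<le> real ?\<Omega>"
    by (intro LIMSEQ_le_const2) auto
  then show ?thesis by simp
qed

end
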